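(* Let $X_t\in\mathbb{R}^m$ be the solution to an SDE $dX_t=b(t,X_t)\,dt+\sigma(t)\,dB_t$, $0\le t\le T$, with initial condition $X_0=x_0$, and define the Malliavin matrix $$\gamma(t)=Y_t\left(\int_0^tY_s^{-1}\sigma(s)\sigma(s)^\top Y_s^{-\top}\,ds\right)Y_t^\top,$$ where $Y_t$ is the first variation process and $\sigma(s)$ is the diffusion coefficient; write $\gamma_{X_T}=\gamma(T)$. Then, for the VE, VP and sub-VP SDEs (each as specified in items 2, 3, 4 below): 1. (Singularity behaviour as $t\to0$.) - For the VE SDE: $\gamma^{-1}(t)=O\left(\frac1t\right)$. - For the VP SDE: $\gamma^{-1}(t)=O\left(\frac1t\right)$. - For the sub-VP SDE: $\gamma^{-1}(t)=O\left(\frac1{t^2}\right)$. Without regularisation, $\gamma^{-1}(t)$ becomes singular as $t\to0$, with the sub-VP SDE demonstrating a stronger divergence rate. 2. (Analytical form for the VP SDE.) For the Variance Preserving SDE $$dX_t=-\tfrac12\beta(t)X_t\,dt+\sqrt{\beta(t)}\,dB_t,$$ where $\beta(t)$ is continuous on $[0,T]$ with $\beta(t)\ge\beta_{\min}>0$, $\beta(0)=\beta_{\min}$ and $\beta(T)=\beta_{\max}\ge\beta_{\min}$, the inverse Malliavin matrix at time $T$ is $$\gamma_{X_T}^{-1}=\frac{1}{1-e^{-B(T)}}\,I_m,\qquad B(T)=\int_0^T\beta(s)\,ds.$$ 3. (Analytical form for the VE SDE.) For the Variance Exploding SDE $$dX_t=\sqrt{\frac{d\sigma^2(t)}{dt}}\,dB_t,\qquad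 \sigma(t)=\sigma_{\min}\left(\frac{\sigma_{\max}}{\sigma_{\min}}\right)^{t/T},$$ with $0<\sigma_{\min}<\sigma_{\max}$ and $T>0$, the inverse Malliavin matrix at time $T$ is $$\gamma_{X_T}^{-1}=\frac{1}{\sigma_{\max}^2-\sigma_{\min}^2}\,I_m.$$ (In this item $\sigma(t)$ denotes the noise scale; the diffusion coefficient entering the definition of $\gamma$ is $\sqrt{d\sigma^2(t)/dt}\,I_m$.) 4. (Analytical form for the sub-VP SDE.) For the sub-Variance Preserving SDE $$dX_t=-\tfrac12\beta(t)X_t\,dt+\sqrt{\beta(t)\left(1-e^{-2\int_0^t\beta(s)\,ds}\right)}\,dB_t,$$ with $B(T)=\int_0^T\beta(s)\,ds>0$ and continuous $\beta(t)\ge\beta_{\min}>0$, the inverse Malliavin matrix at time $T$ is $$\gamma_{X_T}^{-1}=\frac{1}{\left(1-e^{-B(T)}\right)^2}\,I_m.$$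
   Context: $B_t$ (with subscript) is an $m$-dimensional standard Brownian motion, appearing only as the integrator $dB_t$; $B(T)$ (with parentheses) denotes $\int_0^T\beta(s)\,ds$. $I_m$ is the $m\times m$ identity matrix. Scalar diffusion coefficients in the three SDEs are understood as multiplied by $I_m$. The first variation process is $Y_t=\partial X_t/\partial x_0\in\mathbb{R}^{m\times m}$; when the diffusion coefficient does not depend on the state it solves $dY_t=\partial_xb(t,X_t)Y_t\,dt$, $Y_0=I_m$. VE, VP and sub-VP stand for Variance Exploding, Variance Preserving and sub-Variance Preserving. *)

theory Defs
  imports "HOL-Probability.Probability" "HOL-Library.Landau_Symbols"
begin

text \<open>Times are real numbers; a process is a function of time and of the sample point.
  The space \<open>real ^ 'm\<close> carries the dimension \<open>m\<close> in the index type \<open>'m\<close>.\<close>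

definition brownian_motion :: "'w measure \<Rightarrow> (real \<Rightarrow> 'w \<Rightarrow> real ^ 'm) \<Rightarrow> bool" where
  "brownian_motion M B \<longleftrightarrow>
     prob_space M \<and>
     (\<forall>t\<ge>0. B t \<in> borel_measurable M) \<and>
     (AE \<omega> in M. B 0 \<omega> = 0) \<and>
     (AE \<omega> in M. continuous_on {0..} (\<lambda>t. B t \<omega>)) \<and>
     (\<forall>p :: nat \<Rightarrow> real. \<forall>n. 0 \<le> p 0 \<and> (\<forall>k<n. p k < p (Suc k)) \<longrightarrow>
        prob_space.indep_vars M (\<lambda>_. borel) (\<lambda>k \<omega>. B (p (Suc k)) \<omega> - B (p k) \<omega>) {..<n}) \<and>
     (\<forall>s t. 0 \<le> s \<and> s < t \<longrightarrow>
        prob_space.indep_vars M (\<lambda>_. borel) (\<lambda>i \<omega>. (B t \<omega> - B s \<omega>) $ i) (UNIV :: 'm set) \<and>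
        (\<forall>i. distributed M lborel (\<lambda>\<omega>. (B t \<omega> - B s \<omega>) $ i)
               (\<lambda>x. ennreal (normal_density 0 (sqrt (t - s)) x))))"

text \<open>The stochastic integral is only needed for deterministic, continuous, matrix-valued
  integrands. For these the Ito integral over \<open>[0, t]\<close> is the limit in \<open>L\<^sup>2\<close> of the
  left-endpoint Riemann sums as the mesh of the partition \<open>0 = p 0 < \<dots> < p N = t\<close> tends to 0.
  It is determined up to null sets, hence a predicate.\<close>

definition ito_sum ::
  "(real \<Rightarrow> real ^ 'm ^ 'm) \<Rightarrow> (real \<Rightarrow> 'w \<Rightarrow> real ^ 'm) \<Rightarrow> (nat \<Rightarrow> real) \<Rightarrow> nat \<Rightarrow> 'w \<Rightarrow> real ^ 'm" where
  "ito_sum \<sigma> B p N \<omega> = (\<Sum>k<N. \<sigma> (p k) *v (B (p (Suc k)) \<omega> - B (p k) \<omega>))"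

definition has_ito_integral ::
  "'w measure \<Rightarrow> (real \<Rightarrow> 'w \<Rightarrow> real ^ 'm) \<Rightarrow> (real \<Rightarrow> real ^ 'm ^ 'm) \<Rightarrow> real \<Rightarrow> ('w \<Rightarrow> real ^ 'm) \<Rightarrow> bool"
where
  "has_ito_integral M B \<sigma> t I \<longleftrightarrow>
     I \<in> borel_measurable M \<and>
     (\<forall>\<epsilon>>0. \<exists>\<delta>>0. \<forall>(p :: nat \<Rightarrow> real) N.
        p 0 = 0 \<and> p N = t \<and> (\<forall>k<N. p k < p (Suc k) \<and> p (Suc k) - p k < \<delta>) \<longrightarrow>
        (\<integral>\<^sup>+\<omega>. ennreal ((norm (ito_sum \<sigma> B p N \<omega> - I \<omega>))\<^sup>2) \<partial>M) < ennreal \<epsilon>)"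

text \<open>Solutions of \<open>dX\<^sub>t = b(t, X\<^sub>t) dt + \<sigma>(t) dB\<^sub>t\<close>, \<open>X\<^sub>0 = x0\<close>, on \<open>[0, T]\<close>. No adaptedness is
  demanded: the integrand of the stochastic integral is deterministic.\<close>

definition sde_solution ::
  "'w measure \<Rightarrow> (real \<Rightarrow> 'w \<Rightarrow> real ^ 'm) \<Rightarrow> real \<Rightarrow> (real \<Rightarrow> real ^ 'm \<Rightarrow> real ^ 'm) \<Rightarrow>
   (real \<Rightarrow> real ^ 'm ^ 'm) \<Rightarrow> real ^ 'm \<Rightarrow> (real \<Rightarrow> 'w \<Rightarrow> real ^ 'm) \<Rightarrow> bool"
where
  "sde_solution M B T b \<sigma> x0 X \<longleftrightarrow>
     (\<forall>t\<in>{0..T}. X t \<in> borel_measurable M) \<and>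
     (AE \<omega> in M. continuous_on {0..T} (\<lambda>t. X t \<omega>)) \<and>
     (AE \<omega> in M. (\<lambda>s. b s (X s \<omega>)) absolutely_integrable_on {0..T}) \<and>
     (\<forall>t\<in>{0..T}. \<exists>I. has_ito_integral M B \<sigma> t I \<and>
        (AE \<omega> in M. X t \<omega> = x0 + integral {0..t} (\<lambda>s. b s (X s \<omega>)) + I \<omega>))"

text \<open>The first variation process differentiates the solution in its starting point, so the
  solutions are considered for all starting points at once, in a version \<open>X x t \<omega>\<close> that is
  differentiable in \<open>x\<close>.\<close>

definition sde_flow ::
  "'w measure \<Rightarrow> (real \<Rightarrow> 'w \<Rightarrow> real ^ 'm) \<Rightarrow> real \<Rightarrow> (real \<Rightarrow> real ^ 'm \<Rightarrow> real ^ 'm) \<Rightarrow>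
   (real \<Rightarrow> real ^ 'm ^ 'm) \<Rightarrow> (real ^ 'm \<Rightarrow> real \<Rightarrow> 'w \<Rightarrow> real ^ 'm) \<Rightarrow> bool"
where
  "sde_flow M B T b \<sigma> X \<longleftrightarrow>
     (\<forall>x. sde_solution M B T b \<sigma> x (X x)) \<and>
     (AE \<omega> in M. \<forall>t\<in>{0..T}. \<forall>x. (\<lambda>y. X y t \<omega>) differentiable (at x))"

definition first_variation ::
  "(real ^ 'm \<Rightarrow> real \<Rightarrow> 'w \<Rightarrow> real ^ 'm) \<Rightarrow> real ^ 'm \<Rightarrow> real \<Rightarrow> 'w \<Rightarrow> real ^ 'm ^ 'm" where
  "first_variation X x0 t \<omega> = jacobian (\<lambda>x. X x t \<omega>) (at x0)"

definition malliavin_matrix ::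
  "(real \<Rightarrow> real ^ 'm ^ 'm) \<Rightarrow> (real ^ 'm \<Rightarrow> real \<Rightarrow> 'w \<Rightarrow> real ^ 'm) \<Rightarrow> real ^ 'm \<Rightarrow> real \<Rightarrow> 'w \<Rightarrow>
   real ^ 'm ^ 'm"
where
  "malliavin_matrix \<sigma> X x0 t \<omega> =
     (let Y = (\<lambda>s. first_variation X x0 s \<omega>) in
      Y t ** integral {0..t} (\<lambda>s. matrix_inv (Y s) ** \<sigma> s ** transpose (\<sigma> s) **
                                   transpose (matrix_inv (Y s))) ** transpose (Y t))"

definition int_schedule :: "(real \<Rightarrow> real) \<Rightarrow> real \<Rightarrow> real" where
  "int_schedule \<beta> t = integral {0..t} \<beta>"

definition ve_scale :: "real \<Rightarrow> real \<Rightarrow> real \<Rightarrow> real \<Rightarrow> real" where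
  "ve_scale T \<sigma>min \<sigma>max t = \<sigma>min * (\<sigma>max / \<sigma>min) powr (t / T)"

definition ve_drift :: "real \<Rightarrow> real ^ 'm \<Rightarrow> real ^ 'm" where
  "ve_drift t x = 0"

definition ve_diffusion :: "real \<Rightarrow> real \<Rightarrow> real \<Rightarrow> real \<Rightarrow> real ^ 'm ^ 'm" where
  "ve_diffusion T \<sigma>min \<sigma>max t = sqrt (deriv (\<lambda>s. (ve_scale T \<sigma>min \<sigma>max s)\<^sup>2) t) *\<^sub>R mat 1"

definition vp_drift :: "(real \<Rightarrow> real) \<Rightarrow> real \<Rightarrow> real ^ 'm \<Rightarrow> real ^ 'm" where
  "vp_drift \<beta> t x = (- (1 / 2) * \<beta> t) *\<^sub>R x"

definition vp_diffusion :: "(real \<Rightarrow> real) \<Rightarrow> real \<Rightarrow> real ^ 'm ^ 'm" where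
  "vp_diffusion \<beta> t = sqrt (\<beta> t) *\<^sub>R mat 1"

definition subvp_diffusion :: "(real \<Rightarrow> real) \<Rightarrow> real \<Rightarrow> real ^ 'm ^ 'm" where
  "subvp_diffusion \<beta> t = sqrt (\<beta> t * (1 - exp (- 2 * int_schedule \<beta> t))) *\<^sub>R mat 1"

definition ve_flow ::
  "'w measure \<Rightarrow> (real \<Rightarrow> 'w \<Rightarrow> real ^ 'm) \<Rightarrow> real \<Rightarrow> real \<Rightarrow> real \<Rightarrow>
   (real ^ 'm \<Rightarrow> real \<Rightarrow> 'w \<Rightarrow> real ^ 'm) \<Rightarrow> bool"
where
  "ve_flow M B T \<sigma>min \<sigma>max X \<longleftrightarrow>
     0 < \<sigma>min \<and> \<sigma>min < \<sigma>max \<and>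
     sde_flow M B T ve_drift (ve_diffusion T \<sigma>min \<sigma>max) X"

definition vp_flow ::
  "'w measure \<Rightarrow> (real \<Rightarrow> 'w \<Rightarrow> real ^ 'm) \<Rightarrow> real \<Rightarrow> real \<Rightarrow> real \<Rightarrow> (real \<Rightarrow> real) \<Rightarrow>
   (real ^ 'm \<Rightarrow> real \<Rightarrow> 'w \<Rightarrow> real ^ 'm) \<Rightarrow> bool"
where
  "vp_flow M B T \<beta>min \<beta>max \<beta> X \<longleftrightarrow>
     continuous_on {0..T} \<beta> \<and> 0 < \<beta>min \<and> (\<forall>t\<in>{0..T}. \<beta>min \<le> \<beta> t) \<and>
     \<beta> 0 = \<beta>min \<and> \<beta> T = \<beta>max \<and> \<beta>min \<le> \<beta>max \<and>
     sde_flow M B T (vp_drift \<beta>) (vp_diffusion \<beta>) X"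

definition subvp_flow ::
  "'w measure \<Rightarrow> (real \<Rightarrow> 'w \<Rightarrow> real ^ 'm) \<Rightarrow> real \<Rightarrow> real \<Rightarrow> (real \<Rightarrow> real) \<Rightarrow>
   (real ^ 'm \<Rightarrow> real \<Rightarrow> 'w \<Rightarrow> real ^ 'm) \<Rightarrow> bool"
where
  "subvp_flow M B T \<beta>min \<beta> X \<longleftrightarrow>
     continuous_on {0..T} \<beta> \<and> 0 < \<beta>min \<and> (\<forall>t\<in>{0..T}. \<beta>min \<le> \<beta> t) \<and>
     0 < int_schedule \<beta> T \<and>
     sde_flow M B T (vp_drift \<beta>) (subvp_diffusion \<beta>) X"

end

(* For a linear drift a(t) x the stochastic integral does not depend on the starting point, so it
   cancels in the difference D of two solutions: D t = x + \<integral> a(s) D(s) ds along almost every path.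
   Hence D t = exp(A t) x with A t = \<integral> a(s) ds, the first variation process is exp(A t) I, and for
   a scalar diffusion g the Malliavin matrix is exp(2 A t) (\<integral> g(s)^2 exp(-2 A s) ds) I.
   The scalar factor is \<sigma>(t)^2 - \<sigma>(0)^2 for VE, 1 - exp(-B(t)) for VP and (1 - exp(-B(t)))^2 for
   sub-VP: a simple zero at t = 0 in the first two cases, a double zero in the third. *)

theory Submission
  imports Defs
begin

section \<open>Almost sure uniqueness of the Ito integral\<close>

lemma ito_sum_measurable:
  fixes B :: "real \<Rightarrow> 'w \<Rightarrow> real ^ 'm"
  assumes "\<forall>t\<ge>0. B t \<in> borel_measurable M" "\<forall>k\<le>N. 0 \<le> p k"
  shows "ito_sum \<sigma> B p N \<in> borel_measurable M"
proof -
  have "(\<lambda>\<omega>. \<sigma> (p k) *v (B (p (Suc k)) \<omega> - B (p k) \<omega>)) \<in> borel_measurable M" if "k < N" for k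
  proof -
    have "(\<lambda>x. \<sigma> (p k) *v x) \<in> borel_measurable borel"
      by (intro borel_measurable_continuous_onI linear_continuous_on
          matrix_vector_mul_bounded_linear)
    moreover have "(\<lambda>\<omega>. B (p (Suc k)) \<omega> - B (p k) \<omega>) \<in> borel_measurable M"
      using assms that by (intro borel_measurable_diff) auto
    ultimately show ?thesis by (rule measurable_compose[rotated])
  qed
  then show ?thesis
    unfolding ito_sum_def by (intro borel_measurable_sum) auto
qed

text \<open>Both candidates are \<open>L\<^sup>2\<close> limits of the same left-endpoint sums, so
  one sum on a mesh fine enough for both lies close to each of them. Since
  \<open>has_ito_integral\<close> is only a predicate, this is what lets the stochastic integrals of
  two solutions cancel.\<close>

lemma has_ito_integral_unique:
  fixes B :: "real \<Rightarrow> 'w \<Rightarrow> real ^ 'm"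
  assumes B: "\<forall>t\<ge>0. B t \<in> borel_measurable M" and t: "0 \<le> t"
    and I: "has_ito_integral M B \<sigma> t I" and J: "has_ito_integral M B \<sigma> t J"
  shows "AE \<omega> in M. I \<omega> = J \<omega>"
proof -
  have [measurable]: "I \<in> borel_measurable M" "J \<in> borel_measurable M"
    using I J by (auto simp: has_ito_integral_def)
  let ?L = "\<integral>\<^sup>+\<omega>. ennreal ((norm (I \<omega> - J \<omega>))\<^sup>2) \<partial>M"
  \<comment> \<open>Each candidate contributes \<open>2 * \<epsilon>\<close>, hence the factor 4.
    The summand 0 gives the bound the shape that \<open>ennreal_le_epsilon\<close> asks for.\<close>
  have bound: "?L \<le> 0 + ennreal (4 * \<epsilon>)" if "\<epsilon> > 0" for \<epsilon>
  proof -
    obtain d where d: "d > 0" and dI: "\<forall>(p :: nat \<Rightarrow> real) N.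
        p 0 = 0 \<and> p N = t \<and> (\<forall>k<N. p k < p (Suc k) \<and> p (Suc k) - p k < d) \<longrightarrow>
        (\<integral>\<^sup>+\<omega>. ennreal ((norm (ito_sum \<sigma> B p N \<omega> - I \<omega>))\<^sup>2) \<partial>M) < ennreal \<epsilon>"
      using I \<open>\<epsilon> > 0\<close> unfolding has_ito_integral_def by blast
    obtain e where e: "e > 0" and eJ: "\<forall>(p :: nat \<Rightarrow> real) N.
        p 0 = 0 \<and> p N = t \<and> (\<forall>k<N. p k < p (Suc k) \<and> p (Suc k) - p k < e) \<longrightarrow>
        (\<integral>\<^sup>+\<omega>. ennreal ((norm (ito_sum \<sigma> B p N \<omega> - J \<omega>))\<^sup>2) \<partial>M) < ennreal \<epsilon>"
      using J \<open>\<epsilon> > 0\<close> unfolding has_ito_integral_def by blast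
    \<comment> \<open>A uniform partition of step \<open>t / n\<close> serves, or the empty one if
      \<open>t = 0\<close>. All partition points are required to be nonnegative because
      \<open>B\<close> is known to be measurable only at such times.\<close>
    obtain p N where p: "p 0 = 0" "p N = t" and nn: "\<And>k. (0::real) \<le> p k"
      and mesh: "\<forall>k<N. p k < p (Suc k) \<and> p (Suc k) - p k < min d e"
    proof (cases "t = 0")
      case True
      show ?thesis by (rule that[of "\<lambda>_. 0" 0]) (use True in auto)
    next
      case False
      then have "t > 0" using t by simp
      obtain n :: nat where n: "t / min d e < real n" using reals_Archimedean2 by blast
      then have "0 < real n" using \<open>t > 0\<close> d e by (smt (verit) divide_pos_pos min_def)
      define c where "c = t / n"
      have "c < min d e"
        using n d e \<open>0 < real n\<close> unfolding c_def by (simp add: field_simps min_def split: if_splits)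
      moreover have "0 < c" "n * c = t" using \<open>t > 0\<close> \<open>0 < real n\<close> by (auto simp: c_def)
      ultimately show ?thesis by (intro that[of "\<lambda>k. k * c" n]) (auto simp: distrib_right)
    qed
    define S where "S = ito_sum \<sigma> B p N"
    have [measurable]: "S \<in> borel_measurable M"
      unfolding S_def using B nn by (intro ito_sum_measurable) auto
    have SI: "(\<integral>\<^sup>+\<omega>. ennreal ((norm (S \<omega> - I \<omega>))\<^sup>2) \<partial>M) < ennreal \<epsilon>"
      unfolding S_def using mesh p by (intro dI[rule_format]) auto
    have SJ: "(\<integral>\<^sup>+\<omega>. ennreal ((norm (S \<omega> - J \<omega>))\<^sup>2) \<partial>M) < ennreal \<epsilon>"
      unfolding S_def using mesh p by (intro eJ[rule_format]) auto
    have "(norm (I \<omega> - J \<omega>))\<^sup>2 \<le> 2 * (norm (S \<omega> - I \<omega>))\<^sup>2 + 2 * (norm (S \<omega> - J \<omega>))\<^sup>2" for \<omega>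
    proof -
      have "norm (I \<omega> - J \<omega>) \<le> norm (S \<omega> - I \<omega>) + norm (S \<omega> - J \<omega>)"
        using norm_triangle_ineq4[of "S \<omega> - J \<omega>" "S \<omega> - I \<omega>"] by simp
      then have "(norm (I \<omega> - J \<omega>))\<^sup>2 \<le> (norm (S \<omega> - I \<omega>) + norm (S \<omega> - J \<omega>))\<^sup>2"
        by (intro power_mono) auto
      also have "\<dots> \<le> 2 * (norm (S \<omega> - I \<omega>))\<^sup>2 + 2 * (norm (S \<omega> - J \<omega>))\<^sup>2"
        using sum_squares_bound[of "norm (S \<omega> - I \<omega>)" "norm (S \<omega> - J \<omega>)"]
        by (simp add: power2_sum)
      finally show ?thesis .
    qed
    then have "?L \<le> (\<integral>\<^sup>+\<omega>. ennreal (2 * (norm (S \<omega> - I \<omega>))\<^sup>2 + 2 * (norm (S \<omega> - J \<omega>))\<^sup>2) \<partial>M)"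
      by (intro nn_integral_mono ennreal_leI)
    also have "\<dots> = (\<integral>\<^sup>+\<omega>. 2 * ennreal ((norm (S \<omega> - I \<omega>))\<^sup>2) + 2 * ennreal ((norm (S \<omega> - J \<omega>))\<^sup>2) \<partial>M)"
      by (intro nn_integral_cong) (simp add: ennreal_plus ennreal_mult)
    also have "\<dots> = 2 * (\<integral>\<^sup>+\<omega>. ennreal ((norm (S \<omega> - I \<omega>))\<^sup>2) \<partial>M)
                  + 2 * (\<integral>\<^sup>+\<omega>. ennreal ((norm (S \<omega> - J \<omega>))\<^sup>2) \<partial>M)"
      by (simp add: nn_integral_add nn_integral_cmult)
    also have "\<dots> \<le> 2 * ennreal \<epsilon> + 2 * ennreal \<epsilon>"
      using SI SJ by (intro add_mono mult_left_mono) auto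
    also have "\<dots> = ennreal (2 * \<epsilon>) + ennreal (2 * \<epsilon>)"
      using that by (simp add: ennreal_mult)
    also have "\<dots> = ennreal (4 * \<epsilon>)"
      using that by (simp add: ennreal_plus[symmetric] del: ennreal_plus)
    finally show ?thesis by simp
  qed
  have "?L \<le> 0"
  proof (rule ennreal_le_epsilon)
    fix e :: real assume "0 < e"
    then show "?L \<le> 0 + ennreal e" using bound[of "e / 4"] by simp
  qed
  then have "AE \<omega> in M. ennreal ((norm (I \<omega> - J \<omega>))\<^sup>2) = 0"
    by (subst (asm) le_zero_eq, subst (asm) nn_integral_0_iff_AE) auto
  then show ?thesis by eventually_elim auto
qed

section \<open>Linear integral equations and the flow of a linear SDE\<close>

text \<open>Integrating factor: in the derivative of \<open>exp (- A t) *\<^sub>R D t\<close>, where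
  \<open>A\<close> is the integral of \<open>a\<close>, the two product rule terms cancel. The
  function is thus constant on the interval, and its value at 0 is \<open>x\<close>.\<close>

lemma linear_integral_equation_unique:
  fixes D :: "real \<Rightarrow> 'a :: euclidean_space"
  assumes a: "continuous_on {0..T} a" and D: "continuous_on {0..T} D"
    and eq: "\<And>t. t \<in> {0..T} \<Longrightarrow> D t = x + integral {0..t} (\<lambda>s. a s *\<^sub>R D s)"
    and t: "t \<in> {0..T}"
  shows "D t = exp (integral {0..t} a) *\<^sub>R x"
proof -
  let ?A = "\<lambda>t. integral {0..t} a"
  let ?E = "\<lambda>t. exp (- ?A t) *\<^sub>R D t"
  have dA: "(?A has_real_derivative a s) (at s within {0..T})" if "s \<in> {0..T}" for s
    using integral_has_vector_derivative[OF a that]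
    by (simp add: has_real_derivative_iff_has_vector_derivative)
  have dD: "(D has_vector_derivative a s *\<^sub>R D s) (at s within {0..T})" if s: "s \<in> {0..T}" for s
  proof -
    have "((\<lambda>t. integral {0..t} (\<lambda>s. a s *\<^sub>R D s)) has_vector_derivative a s *\<^sub>R D s)
        (at s within {0..T})"
      using integral_has_vector_derivative[OF _ s, of "\<lambda>s. a s *\<^sub>R D s"] a D
      by (auto intro: continuous_intros)
    then have "((\<lambda>t. x + integral {0..t} (\<lambda>s. a s *\<^sub>R D s)) has_vector_derivative a s *\<^sub>R D s)
        (at s within {0..T})"
      by (auto intro!: derivative_eq_intros)
    then show ?thesis
      by (rule has_vector_derivative_transform[OF s, rotated]) (rule eq)
  qed
  have "(?E has_derivative (\<lambda>h. 0)) (at s within {0..T})" if s: "s \<in> {0..T}" for s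
  proof -
    have "((\<lambda>s. exp (- ?A s)) has_real_derivative exp (- ?A s) * (- a s)) (at s within {0..T})"
      using dA[OF s] by (auto intro!: derivative_eq_intros)
    from has_vector_derivative_scaleR[OF this dD[OF s]] show ?thesis
      by (simp add: has_vector_derivative_def)
  qed
  then obtain c where c: "\<And>s. s \<in> {0..T} \<Longrightarrow> ?E s = c"
    using has_derivative_zero_constant[of "{0..T}" ?E] by auto
  have "0 \<in> {0..T}" using t by auto
  then have "c = x" using c[of 0] eq[of 0] by simp
  then have "exp (?A t) *\<^sub>R ?E t = exp (?A t) *\<^sub>R x" using c[OF t] by simp
  then show ?thesis by (simp add: exp_minus)
qed

text \<open>The difference of two solutions solves a deterministic linear equation, because the
  noise does not see the starting point. This is first known outside a null set that depends on the
  time and on the starting point. Countable dense sets of both leave a single null set; continuity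
  of the paths in time, and of the differentiable flow in the starting point, then extends the
  formula to all times and all points.\<close>

lemma sde_linear_flow:
  fixes B :: "real \<Rightarrow> 'w \<Rightarrow> real ^ 'm"
  assumes B: "brownian_motion M B"
    and flow: "sde_flow M B T (\<lambda>t x. a t *\<^sub>R x) \<sigma> X"
    and a: "continuous_on {0..T} a"
  shows "AE \<omega> in M. \<forall>t\<in>{0..T}. \<forall>x. X x t \<omega> = X 0 t \<omega> + exp (integral {0..t} a) *\<^sub>R x"
proof -
  have Bm: "\<forall>t\<ge>0. B t \<in> borel_measurable M" using B by (simp add: brownian_motion_def)
  have sol: "sde_solution M B T (\<lambda>t x. a t *\<^sub>R x) \<sigma> x (X x)" for x
    using flow by (simp add: sde_flow_def)
  obtain Q where Q: "countable Q" "Q \<subseteq> {0..T}" "{0..T} \<subseteq> closure Q"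
    using separable[of "{0..T}"] by metis
  obtain D where D: "countable D" "(UNIV :: (real ^ 'm) set) \<subseteq> closure D"
    using separable[of "UNIV :: (real ^ 'm) set"] by metis
  \<comment> \<open>The two time integrals stay separate here: merging them needs integrability of
    each integrand, which is read off later from the continuity of the paths.\<close>
  have diff: "AE \<omega> in M. X x t \<omega> - X 0 t \<omega> = x + (integral {0..t} (\<lambda>s. a s *\<^sub>R X x s \<omega>)
      - integral {0..t} (\<lambda>s. a s *\<^sub>R X 0 s \<omega>))" if "t \<in> {0..T}" for x t
  proof -
    obtain I where I: "has_ito_integral M B \<sigma> t I"
      "AE \<omega> in M. X x t \<omega> = x + integral {0..t} (\<lambda>s. a s *\<^sub>R X x s \<omega>) + I \<omega>"
      using sol[of x] \<open>t \<in> {0..T}\<close> unfolding sde_solution_def by blast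
    obtain J where J: "has_ito_integral M B \<sigma> t J"
      "AE \<omega> in M. X 0 t \<omega> = 0 + integral {0..t} (\<lambda>s. a s *\<^sub>R X 0 s \<omega>) + J \<omega>"
      using sol[of 0] \<open>t \<in> {0..T}\<close> unfolding sde_solution_def by blast
    have "AE \<omega> in M. I \<omega> = J \<omega>"
      using has_ito_integral_unique[OF Bm _ I(1) J(1)] that by simp
    with I(2) J(2) show ?thesis by eventually_elim simp
  qed
  have "AE \<omega> in M. \<forall>x\<in>D. \<forall>t\<in>Q. X x t \<omega> - X 0 t \<omega> = x + (integral {0..t} (\<lambda>s. a s *\<^sub>R X x s \<omega>)
      - integral {0..t} (\<lambda>s. a s *\<^sub>R X 0 s \<omega>))"
    using D Q diff by (intro AE_ball_countable[THEN iffD2] ballI) auto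
  moreover have "AE \<omega> in M. \<forall>x\<in>D. continuous_on {0..T} (\<lambda>t. X x t \<omega>)"
    using D sol by (intro AE_ball_countable[THEN iffD2] ballI) (auto simp: sde_solution_def)
  moreover have "AE \<omega> in M. continuous_on {0..T} (\<lambda>t. X 0 t \<omega>)"
    using sol by (auto simp: sde_solution_def)
  moreover have "AE \<omega> in M. \<forall>t\<in>{0..T}. \<forall>x. (\<lambda>y. X y t \<omega>) differentiable (at x)"
    using flow by (simp add: sde_flow_def)
  ultimately show ?thesis
  proof eventually_elim
    case (elim \<omega>)
    note c0 = elim(3)
    have onD: "X x t \<omega> - X 0 t \<omega> = exp (integral {0..t} a) *\<^sub>R x" if x: "x \<in> D" and t: "t \<in> {0..T}"
      for x t
    proof (rule linear_integral_equation_unique[OF a _ _ t])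
      have cx: "continuous_on {0..T} (\<lambda>t. X x t \<omega>)" using elim(2) x by blast
      show cd: "continuous_on {0..T} (\<lambda>t. X x t \<omega> - X 0 t \<omega>)"
        using cx c0 by (intro continuous_intros)
      \<comment> \<open>First density argument, for fixed \<open>\<omega>\<close> and
        \<open>x\<close>: the residual of the integral equation is continuous in time and vanishes
        on \<open>Q\<close>, so its zero set is closed in the interval and contains the closure of
        \<open>Q\<close>.\<close>
      let ?R = "\<lambda>t. X x t \<omega> - X 0 t \<omega> - (x + integral {0..t} (\<lambda>s. a s *\<^sub>R (X x s \<omega> - X 0 s \<omega>)))"
      have int: "(\<lambda>s. a s *\<^sub>R X x s \<omega>) integrable_on {0..t}" "(\<lambda>s. a s *\<^sub>R X 0 s \<omega>) integrable_on {0..t}"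
        if "t \<le> T" for t
        using a cx c0 that
        by (auto intro!: integrable_continuous_real continuous_intros elim: continuous_on_subset)
      have "(\<lambda>s. a s *\<^sub>R (X x s \<omega> - X 0 s \<omega>)) integrable_on {0..T}"
        by (intro integrable_continuous_real continuous_on_scaleR a cd)
      then have "continuous_on {0..T} ?R"
        by (intro continuous_intros cx c0 indefinite_integral_continuous_1)
      then have "closed {t \<in> {0..T}. ?R t = 0}"
        by (intro continuous_closed_preimage_constant) auto
      moreover have "Q \<subseteq> {t \<in> {0..T}. ?R t = 0}"
      proof
        fix t assume "t \<in> Q"
        then have "t \<in> {0..T}" using Q by auto
        moreover have "X x t \<omega> - X 0 t \<omega> = x + (integral {0..t} (\<lambda>s. a s *\<^sub>R X x s \<omega>)
            - integral {0..t} (\<lambda>s. a s *\<^sub>R X 0 s \<omega>))"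
          using elim(1) x \<open>t \<in> Q\<close> by blast
        ultimately show "t \<in> {t \<in> {0..T}. ?R t = 0}"
          using int by (simp add: scaleR_diff_right integral_diff)
      qed
      ultimately have "closure Q \<subseteq> {t \<in> {0..T}. ?R t = 0}" by (rule closure_minimal[rotated])
      then have R: "{0..T} \<subseteq> {t \<in> {0..T}. ?R t = 0}" using Q by blast
      show "X x t \<omega> - X 0 t \<omega> = x + integral {0..t} (\<lambda>s. a s *\<^sub>R (X x s \<omega> - X 0 s \<omega>))"
        if "t \<in> {0..T}" for t
        using subsetD[OF R that] by simp
    qed
    show ?case
    proof (intro ballI allI)
      fix t x assume t: "t \<in> {0..T}"
      \<comment> \<open>Second density argument, now for a fixed time: the residual of the final
        formula is continuous in the starting point and vanishes on \<open>D\<close>.\<close>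
      let ?R = "\<lambda>x. X x t \<omega> - X 0 t \<omega> - exp (integral {0..t} a) *\<^sub>R x"
      have "continuous_on UNIV (\<lambda>x. X x t \<omega>)"
        using elim(4) t
        by (auto simp: continuous_on_eq_continuous_at intro: differentiable_imp_continuous_within)
      then have "continuous_on UNIV ?R" by (intro continuous_intros)
      then have "closed {x \<in> UNIV. ?R x = 0}"
        by (intro continuous_closed_preimage_constant) auto
      moreover have "D \<subseteq> {x \<in> UNIV. ?R x = 0}" using onD t by auto
      ultimately have "closure D \<subseteq> {x \<in> UNIV. ?R x = 0}" by (rule closure_minimal[rotated])
      then have "x \<in> {x \<in> UNIV. ?R x = 0}" using D(2) by blast
      then show "X x t \<omega> = X 0 t \<omega> + exp (integral {0..t} a) *\<^sub>R x" by (simp add: algebra_simps)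
    qed
  qed
qed

section \<open>Scalar matrices and the Malliavin matrix of a linear flow\<close>

lemma matrix_mult_scaled_id:
  fixes A :: "real ^ 'm ^ 'm"
  shows "(c *\<^sub>R mat 1) ** A = c *\<^sub>R A" "A ** (c *\<^sub>R mat 1) = c *\<^sub>R A"
  by (simp_all add: scalar_matrix_assoc[symmetric] matrix_scalar_ac)

lemma invertible_scaled_id:
  fixes c :: real
  assumes "c \<noteq> 0"
  shows "invertible (c *\<^sub>R mat 1 :: real ^ 'm ^ 'm)"
  unfolding invertible_def
  by (rule exI[of _ "(1 / c) *\<^sub>R mat 1"]) (simp add: matrix_mult_scaled_id assms)

lemma matrix_inv_scaled_id:
  fixes c :: real
  assumes "c \<noteq> 0"
  shows "matrix_inv (c *\<^sub>R mat 1 :: real ^ 'm ^ 'm) = (1 / c) *\<^sub>R mat 1"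
proof -
  let ?A = "c *\<^sub>R mat 1 :: real ^ 'm ^ 'm"
  \<comment> \<open>\<open>matrix_inv\<close> is defined by choice, so its defining property becomes
    available through invertibility.\<close>
  have "?A ** matrix_inv ?A = mat 1"
    using invertible_scaled_id[OF assms] unfolding invertible_def matrix_inv_def
    by (rule someI2_ex) auto
  then have "c *\<^sub>R matrix_inv ?A = mat 1" by (simp add: matrix_mult_scaled_id)
  then have "(1 / c) *\<^sub>R (c *\<^sub>R matrix_inv ?A) = (1 / c) *\<^sub>R mat 1" by simp
  then show ?thesis using assms by simp
qed

lemma jacobian_homothety:
  fixes f :: "real ^ 'm \<Rightarrow> real ^ 'm"
  assumes "\<And>x. f x = v + c *\<^sub>R x"
  shows "jacobian f (at x0) = c *\<^sub>R mat 1"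
proof -
  have "(f has_derivative (\<lambda>h. c *\<^sub>R h)) (at x0)"
    unfolding assms by (auto intro!: derivative_eq_intros)
  then have "frechet_derivative f (at x0) = (\<lambda>h. c *\<^sub>R h)"
    by (simp add: frechet_derivative_at[symmetric])
  then show ?thesis
    by (simp add: jacobian_def matrix_scaleR) (simp add: vec_eq_iff mat_def)
qed

text \<open>All matrices involved are multiples of the identity: the two inverse factors contribute
  \<open>exp (- 2 * A s)\<close> under the integral and the two outer factors
  \<open>exp (2 * A t)\<close>. The antiderivative \<open>G\<close> is left as a parameter, since
  each model has one in closed form and the fundamental theorem of calculus then evaluates the
  integral.\<close>

lemma malliavin_matrix_linear_flow:
  fixes B :: "real \<Rightarrow> 'w \<Rightarrow> real ^ 'm" and a g G :: "real \<Rightarrow> real"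
  defines "A \<equiv> \<lambda>t. integral {0..t} a"
  assumes "brownian_motion M B"
    and "sde_flow M B T (\<lambda>t x. a t *\<^sub>R x) \<sigma> X"
    and \<sigma>: "\<And>t. t \<in> {0..T} \<Longrightarrow> \<sigma> t = g t *\<^sub>R mat 1"
    and "continuous_on {0..T} a"
    and G: "\<And>t. t \<in> {0..T} \<Longrightarrow>
      (G has_real_derivative (g t)\<^sup>2 * exp (- 2 * A t)) (at t within {0..T})"
  shows "AE \<omega> in M. \<forall>t\<in>{0..T}.
    malliavin_matrix \<sigma> X x0 t \<omega> = (exp (2 * A t) * (G t - G 0)) *\<^sub>R mat 1"
  using sde_linear_flow[OF assms(2,3,5)]
proof eventually_elim
  case (elim \<omega>)
  have Y: "first_variation X x0 s \<omega> = exp (A s) *\<^sub>R mat 1" if "s \<in> {0..T}" for s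
    unfolding first_variation_def A_def
    by (rule jacobian_homothety[of _ "X 0 s \<omega>"]) (rule elim[rule_format, OF that])
  show ?case
  proof
    fix t assume t: "t \<in> {0..T}"
    let ?f = "\<lambda>s. matrix_inv (first_variation X x0 s \<omega>) ** \<sigma> s ** transpose (\<sigma> s) **
        transpose (matrix_inv (first_variation X x0 s \<omega>))"
    have f: "?f s = ((g s)\<^sup>2 * exp (- 2 * A s)) *\<^sub>R mat 1" if "s \<in> {0..t}" for s
    proof -
      have "exp (- 2 * A s) = inverse (exp (A s)) * inverse (exp (A s))"
        by (simp add: exp_minus[symmetric] exp_add[symmetric])
      then show ?thesis
        using that t
        by (simp add: Y \<sigma> matrix_inv_scaled_id transpose_scalar matrix_mult_scaled_id
            power2_eq_square divide_inverse mult_ac)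
    qed
    have "((\<lambda>s. (g s)\<^sup>2 * exp (- 2 * A s)) has_integral G t - G 0) {0..t}"
    proof (rule fundamental_theorem_of_calculus)
      show "0 \<le> t" using t by simp
      show "(G has_vector_derivative (g s)\<^sup>2 * exp (- 2 * A s)) (at s within {0..t})"
        if "s \<in> {0..t}" for s
        using DERIV_subset[OF G[of s], of "{0..t}"] that t
        by (simp add: has_real_derivative_iff_has_vector_derivative)
    qed
    then have "((\<lambda>s. ((g s)\<^sup>2 * exp (- 2 * A s)) *\<^sub>R mat 1) has_integral
        (G t - G 0) *\<^sub>R (mat 1 :: real ^ 'm ^ 'm)) {0..t}"
      by (rule has_integral_scaleR_left)
    then have "integral {0..t} (\<lambda>s. ((g s)\<^sup>2 * exp (- 2 * A s)) *\<^sub>R mat 1) =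
        (G t - G 0) *\<^sub>R (mat 1 :: real ^ 'm ^ 'm)"
      by (rule integral_unique)
    then have "integral {0..t} ?f = (G t - G 0) *\<^sub>R mat 1"
      by (simp only: integral_cong[OF f])
    then show "malliavin_matrix \<sigma> X x0 t \<omega> = (exp (2 * A t) * (G t - G 0)) *\<^sub>R mat 1"
      using t by (simp add: malliavin_matrix_def Let_def Y transpose_scalar matrix_mult_scaled_id
          exp_add[symmetric] mult_ac)
  qed
qed

section \<open>Behaviour of the inverse near time zero\<close>

text \<open>As \<open>k\<close> vanishes at 0, \<open>k t / t\<close> is its difference quotient and
  tends to \<open>c\<close>; the rescaled norm is \<open>norm (mat 1)\<close> divided by the
  \<open>p\<close>-th power of that quotient. The norm is the Frobenius norm, so
  \<open>norm (mat 1)\<close> is the square root of the dimension and stays in the limit. An exact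
  limit yields the upper bound, the divergence and the comparison of rates alike.\<close>

lemma norm_matrix_inv_scaled_id_tendsto:
  fixes \<Gamma> :: "real \<Rightarrow> real ^ 'm ^ 'm" and k :: "real \<Rightarrow> real"
  assumes "0 < T" and \<Gamma>: "\<And>t. t \<in> {0<..T} \<Longrightarrow> \<Gamma> t = (k t ^ p) *\<^sub>R mat 1"
    and pos: "\<And>t. t \<in> {0<..T} \<Longrightarrow> 0 < k t"
    and k: "(k has_real_derivative c) (at 0 within {0..T})" "k 0 = 0" "c \<noteq> 0"
  shows "((\<lambda>t. norm (matrix_inv (\<Gamma> t)) * t ^ p) \<longlongrightarrow> norm (mat 1 :: real ^ 'm ^ 'm) / c ^ p)
    (at_right 0)"
proof -
  have "((\<lambda>t. k t / t) \<longlongrightarrow> c) (at_right 0)"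
    using k \<open>0 < T\<close> by (simp add: has_field_derivative_iff at_within_Icc_at_right)
  then have "((\<lambda>t. norm (mat 1 :: real ^ 'm ^ 'm) / (k t / t) ^ p) \<longlongrightarrow>
      norm (mat 1 :: real ^ 'm ^ 'm) / c ^ p) (at_right 0)"
    using k(3) by (intro tendsto_intros) auto
  moreover have "\<forall>\<^sub>F t in at_right 0. norm (mat 1 :: real ^ 'm ^ 'm) / (k t / t) ^ p =
      norm (matrix_inv (\<Gamma> t)) * t ^ p"
    using eventually_at_right_real[OF \<open>0 < T\<close>]
  proof eventually_elim
    case (elim t)
    then have "t \<in> {0<..T}" by auto
    then show ?case
      using \<Gamma>[of t] pos[of t] by (simp add: matrix_inv_scaled_id power_divide)
  qed
  ultimately show ?thesis by (rule Lim_transform_eventually)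
qed

context
  fixes f :: "real \<Rightarrow> real" and p :: nat and L :: real
  assumes lim: "((\<lambda>t. f t * t ^ p) \<longlongrightarrow> L) (at_right 0)"
begin

lemma bigo_pole: "f \<in> O[at_right 0](\<lambda>t. 1 / t ^ p)"
proof (rule bigoI_tendsto)
  show "((\<lambda>t. f t / (1 / t ^ p)) \<longlongrightarrow> L) (at_right 0)" using lim by simp
  show "\<forall>\<^sub>F t in at_right 0. 1 / t ^ p \<noteq> (0::real)"
    using eventually_at_right_less[of "0::real"] by eventually_elim simp
qed

text \<open>\<open>f\<close> is eventually the product of \<open>f t * t ^ p\<close>, which has a
  positive limit, and \<open>inverse (t ^ p)\<close>, which tends to infinity.\<close>

lemma filterlim_pole:
  assumes "0 < L" "0 < p"
  shows "filterlim f at_top (at_right 0)"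
proof -
  have "filterlim (\<lambda>t::real. t ^ p) (at_right 0) (at_right 0)"
    unfolding filterlim_at
    using \<open>0 < p\<close> by (auto intro!: tendsto_eq_intros eventually_at_rightI[of 0 1])
  then have "filterlim (\<lambda>t. inverse (t ^ p)) at_top (at_right (0::real))"
    by (rule filterlim_compose[OF filterlim_inverse_at_top_right])
  from filterlim_tendsto_pos_mult_at_top[OF lim \<open>0 < L\<close> this]
  show ?thesis
  proof (rule filterlim_mono_eventually)
    show "\<forall>\<^sub>F t in at_right 0. f t * t ^ p * inverse (t ^ p) = f t"
      using eventually_at_right_less[of "0::real"] by eventually_elim simp
  qed auto
qed

text \<open>The quotient of \<open>f\<close> and \<open>h\<close> is the quotient of the two
  rescaled functions, which tends to \<open>L / K\<close>, times \<open>t ^ (q - p)\<close>, which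
  tends to 0. That \<open>K\<close> is nonzero also keeps \<open>h\<close> away from 0 near the
  origin.\<close>

lemma smallo_higher_pole:
  assumes h: "((\<lambda>t. h t * t ^ q) \<longlongrightarrow> K) (at_right 0)" "K \<noteq> 0" "p < q"
  shows "f \<in> o[at_right 0](h)"
proof (rule smalloI_tendsto)
  have ev: "\<forall>\<^sub>F t in at_right 0. h t * t ^ q \<noteq> 0"
    using h(1,2) by (rule tendsto_imp_eventually_ne)
  then show "\<forall>\<^sub>F t in at_right 0. h t \<noteq> 0" by eventually_elim auto
  have "((\<lambda>t. (f t * t ^ p) / (h t * t ^ q) * t ^ (q - p)) \<longlongrightarrow> L / K * 0 ^ (q - p)) (at_right 0)"
    using h(2) by (intro tendsto_intros lim h(1))
  then have "((\<lambda>t. (f t * t ^ p) / (h t * t ^ q) * t ^ (q - p)) \<longlongrightarrow> 0) (at_right 0)"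
    using \<open>p < q\<close> by (simp only: zero_power zero_less_diff mult_zero_right)
  moreover have "\<forall>\<^sub>F t in at_right 0. (f t * t ^ p) / (h t * t ^ q) * t ^ (q - p) = f t / h t"
    using ev eventually_at_right_less[of "0::real"]
  proof eventually_elim
    case (elim t)
    have "t ^ q = t ^ p * t ^ (q - p)" using \<open>p < q\<close> by (simp add: power_add[symmetric])
    then show ?case using elim by (simp add: field_simps)
  qed
  ultimately show "((\<lambda>t. f t / h t) \<longlongrightarrow> 0) (at_right 0)" by (rule Lim_transform_eventually)
qed

end

text \<open>Common endgame of the three models: \<open>k\<close> has a simple zero at 0, and
  \<open>p\<close> is 1 for VE and VP and 2 for sub-VP. The limit \<open>L\<close> depends only on
  \<open>c\<close>, \<open>p\<close> and the dimension, not on \<open>\<omega>\<close>, so it is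
  obtained outside the almost sure statements; it carries the exact rate needed to compare two
  models.\<close>

lemma AE_isotropic_singularity:
  fixes \<Gamma> :: "real \<Rightarrow> 'w \<Rightarrow> real ^ 'm ^ 'm" and k :: "real \<Rightarrow> real"
  assumes T: "0 < T" and "0 < p"
    and AE: "AE \<omega> in M. \<forall>t\<in>{0..T}. \<Gamma> t \<omega> = (k t ^ p) *\<^sub>R mat 1"
    and pos: "\<And>t. t \<in> {0<..T} \<Longrightarrow> 0 < k t"
    and k: "(k has_real_derivative c) (at 0 within {0..T})" "k 0 = 0" "0 < c"
  obtains L where "0 < L"
    and "AE \<omega> in M. ((\<lambda>t. norm (matrix_inv (\<Gamma> t \<omega>)) * t ^ p) \<longlongrightarrow> L) (at_right 0)"
    and "AE \<omega> in M. (\<forall>t\<in>{0<..T}. invertible (\<Gamma> t \<omega>)) \<and>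
      (\<lambda>t. norm (matrix_inv (\<Gamma> t \<omega>))) \<in> O[at_right 0](\<lambda>t. 1 / t ^ p) \<and>
      filterlim (\<lambda>t. norm (matrix_inv (\<Gamma> t \<omega>))) at_top (at_right 0)"
    and "AE \<omega> in M. matrix_inv (\<Gamma> T \<omega>) = (1 / k T ^ p) *\<^sub>R mat 1"
proof
  let ?L = "norm (mat 1 :: real ^ 'm ^ 'm) / c ^ p"
  \<comment> \<open>An index type is never empty, so the identity matrix is not zero and the limit
    is positive.\<close>
  have "(mat 1 :: real ^ 'm ^ 'm) \<noteq> 0" by (simp add: vec_eq_iff mat_def)
  then show L: "0 < ?L" using k by simp
  show lim: "AE \<omega> in M. ((\<lambda>t. norm (matrix_inv (\<Gamma> t \<omega>)) * t ^ p) \<longlongrightarrow> ?L) (at_right 0)"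
    using AE
  proof eventually_elim
    case (elim \<omega>)
    show ?case
      by (rule norm_matrix_inv_scaled_id_tendsto[OF T _ pos k(1,2)]) (use elim k in auto)
  qed
  have kT: "k t ^ p \<noteq> 0" if "t \<in> {0<..T}" for t using pos[OF that] by simp
  show "AE \<omega> in M. (\<forall>t\<in>{0<..T}. invertible (\<Gamma> t \<omega>)) \<and>
      (\<lambda>t. norm (matrix_inv (\<Gamma> t \<omega>))) \<in> O[at_right 0](\<lambda>t. 1 / t ^ p) \<and>
      filterlim (\<lambda>t. norm (matrix_inv (\<Gamma> t \<omega>))) at_top (at_right 0)"
    using AE lim
  proof eventually_elim
    case (elim \<omega>)
    have "invertible (\<Gamma> t \<omega>)" if "t \<in> {0<..T}" for t
      using elim(1) invertible_scaled_id[OF kT[OF that]] that by simp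
    then show ?case
      using bigo_pole[OF elim(2)] filterlim_pole[OF elim(2) L \<open>0 < p\<close>] by blast
  qed
  show "AE \<omega> in M. matrix_inv (\<Gamma> T \<omega>) = (1 / k T ^ p) *\<^sub>R mat 1"
    using AE
  proof eventually_elim
    case (elim \<omega>)
    show ?case using elim matrix_inv_scaled_id[OF kT[of T]] T by simp
  qed
qed

section \<open>The VE, VP and sub-VP equations\<close>

text \<open>Without drift the first variation is the identity, and the squared diffusion coefficient
  is by construction the derivative of the squared noise scale. The scalar factor is therefore the
  increment of that square, with positive slope everywhere because \<open>\<sigma>max\<close>
  exceeds \<open>\<sigma>min\<close>.\<close>

lemma ve_flow_singularity:
  fixes x0 :: "real ^ 'm"
  assumes T: "0 < T" and "brownian_motion M B" and flow: "ve_flow M B T \<sigma>min \<sigma>max X"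
  defines "\<Gamma> \<equiv> malliavin_matrix (ve_diffusion T \<sigma>min \<sigma>max) X x0"
  obtains L where "0 < L"
    and "AE \<omega> in M. ((\<lambda>t. norm (matrix_inv (\<Gamma> t \<omega>)) * t) \<longlongrightarrow> L) (at_right 0)"
    and "AE \<omega> in M. (\<forall>t\<in>{0<..T}. invertible (\<Gamma> t \<omega>)) \<and>
      (\<lambda>t. norm (matrix_inv (\<Gamma> t \<omega>))) \<in> O[at_right 0](\<lambda>t. 1 / t) \<and>
      filterlim (\<lambda>t. norm (matrix_inv (\<Gamma> t \<omega>))) at_top (at_right 0)"
    and "AE \<omega> in M. matrix_inv (\<Gamma> T \<omega>) = (1 / (\<sigma>max\<^sup>2 - \<sigma>min\<^sup>2)) *\<^sub>R mat 1"
proof -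
  have \<sigma>: "0 < \<sigma>min" "\<sigma>min < \<sigma>max"
    and sde: "sde_flow M B T ve_drift (ve_diffusion T \<sigma>min \<sigma>max) X"
    using flow by (auto simp: ve_flow_def)
  let ?r = "\<sigma>max / \<sigma>min"
  let ?V = "\<lambda>t. (ve_scale T \<sigma>min \<sigma>max t)\<^sup>2"
  let ?d = "\<lambda>t. 2 * (ve_scale T \<sigma>min \<sigma>max t)\<^sup>2 * ln ?r / T"
  have r: "1 < ?r" using \<sigma> by simp
  have "0 < ln ?r" using r by (rule ln_gt_zero)
  \<comment> \<open>\<open>deriv\<close> is the two-sided derivative, at the endpoints of the time
    interval too; the scale is defined and smooth on the whole line, so this closed form covers
    them.\<close>
  have d: "(?V has_real_derivative ?d t) (at t)" for t
  proof -
    have scale: "ve_scale T \<sigma>min \<sigma>max = (\<lambda>t. \<sigma>min * exp (t / T * ln ?r))"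
      using \<sigma> by (simp add: ve_scale_def powr_def fun_eq_iff)
    show ?thesis
      unfolding scale using T by (auto intro!: derivative_eq_intros simp: power2_eq_square)
  qed
  have scale_pos: "0 < ve_scale T \<sigma>min \<sigma>max t" for t using \<sigma> by (simp add: ve_scale_def)
  have d_pos: "0 < ?d t" for t
    using scale_pos[of t] \<open>0 < ln ?r\<close> T by (intro divide_pos_pos mult_pos_pos) auto
  have diffusion: "ve_diffusion T \<sigma>min \<sigma>max t = sqrt (?d t) *\<^sub>R mat 1" for t
    unfolding ve_diffusion_def DERIV_imp_deriv[OF d] ..
  \<comment> \<open>The zero drift is written as a linear one to match the general flow
    lemma.\<close>
  have "sde_flow M B T (\<lambda>t x. 0 *\<^sub>R x) (ve_diffusion T \<sigma>min \<sigma>max) X"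
    using sde by (simp add: ve_drift_def[abs_def])
  then have "AE \<omega> in M. \<forall>t\<in>{0..T}. malliavin_matrix (ve_diffusion T \<sigma>min \<sigma>max) X x0 t \<omega> =
      (exp (2 * integral {0..t} (\<lambda>_. 0)) * (?V t - ?V 0)) *\<^sub>R mat 1"
  proof (rule malliavin_matrix_linear_flow[OF assms(2) _ diffusion])
    show "(?V has_real_derivative (sqrt (?d t))\<^sup>2 * exp (- 2 * integral {0..t} (\<lambda>_. 0)))
        (at t within {0..T})" for t
      using DERIV_subset[OF d[of t]] d_pos[of t] by simp
  qed auto
  then have "AE \<omega> in M. \<forall>t\<in>{0..T}. \<Gamma> t \<omega> = ((?V t - ?V 0) ^ 1) *\<^sub>R mat 1"
    by (simp add: \<Gamma>_def)
  moreover have "0 < ?V t - ?V 0" if "t \<in> {0<..T}" for t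
    using DERIV_pos_imp_increasing[of 0 t ?V] d d_pos that by auto
  moreover have "((\<lambda>t. ?V t - ?V 0) has_real_derivative ?d 0) (at 0 within {0..T})"
    using DERIV_diff[OF DERIV_subset[OF d[of 0]] DERIV_const] by simp
  moreover have "?V T - ?V 0 = \<sigma>max\<^sup>2 - \<sigma>min\<^sup>2" using \<sigma> T by (simp add: ve_scale_def)
  ultimately show ?thesis
    using AE_isotropic_singularity[OF T zero_less_one,
        where \<Gamma> = \<Gamma> and k = "\<lambda>t. ?V t - ?V 0" and M = M and c = "?d 0" and thesis = thesis]
      that d_pos[of 0]
    by simp
qed

lemma int_schedule_has_derivative:
  assumes "continuous_on {0..T} \<beta>" "t \<in> {0..T}"
  shows "(int_schedule \<beta> has_real_derivative \<beta> t) (at t within {0..T})"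
  using integral_has_vector_derivative[OF assms]
  by (simp add: has_real_derivative_iff_has_vector_derivative int_schedule_def[abs_def])

lemma int_schedule_zero [simp]: "int_schedule \<beta> 0 = 0"
  by (simp add: int_schedule_def)

text \<open>Serves to make \<open>1 - exp (- int_schedule \<beta> t)\<close> positive for
  \<open>t > 0\<close> and the radicand of the sub-VP coefficient nonnegative.\<close>

lemma int_schedule_ge:
  assumes "continuous_on {0..T} \<beta>" "\<forall>t\<in>{0..T}. \<beta>min \<le> \<beta> t" "t \<in> {0..T}"
  shows "\<beta>min * t \<le> int_schedule \<beta> t"
proof -
  have "integral {0..t} (\<lambda>_. \<beta>min) \<le> integral {0..t} \<beta>"
    using assms
    by (intro integral_le integrable_continuous_real) (auto elim: continuous_on_subset)
  then show ?thesis using assms(3) by (simp add: int_schedule_def mult.commute)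
qed

text \<open>VP and sub-VP share the rate \<open>- \<beta> / 2\<close>, whose integral is minus half
  of the integrated schedule; doubling it gives the weight
  \<open>exp (int_schedule \<beta> t)\<close> under the integral and its reciprocal outside. Only
  the noise distinguishes the two models.\<close>

lemma vp_drift_flow_malliavin_matrix:
  assumes "brownian_motion M B" and sde: "sde_flow M B T (vp_drift \<beta>) \<sigma> X"
    and \<beta>: "continuous_on {0..T} \<beta>"
    and \<sigma>: "\<And>t. t \<in> {0..T} \<Longrightarrow> \<sigma> t = g t *\<^sub>R mat 1"
    and G: "\<And>t. t \<in> {0..T} \<Longrightarrow>
      (G has_real_derivative (g t)\<^sup>2 * exp (int_schedule \<beta> t)) (at t within {0..T})"
  shows "AE \<omega> in M. \<forall>t\<in>{0..T}.
    malliavin_matrix \<sigma> X x0 t \<omega> = (exp (- int_schedule \<beta> t) * (G t - G 0)) *\<^sub>R mat 1"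
proof -
  let ?a = "\<lambda>t. - (1 / 2) * \<beta> t"
  have A: "integral {0..t} ?a = - (1 / 2) * int_schedule \<beta> t" for t
    unfolding int_schedule_def by (rule integral_mult_right)
  have flow: "sde_flow M B T (\<lambda>t x. ?a t *\<^sub>R x) \<sigma> X"
    using sde unfolding vp_drift_def[abs_def] .
  have "continuous_on {0..T} ?a" using \<beta> by (intro continuous_intros)
  from malliavin_matrix_linear_flow[OF assms(1) flow \<sigma> this, of G x0]
  show ?thesis unfolding A using G by simp
qed

text \<open>Writing u for \<open>int_schedule \<beta> t\<close>, the integrand
  \<open>\<beta> t * exp u\<close> has antiderivative \<open>exp u\<close>, and
  \<open>exp (- u) * (exp u - 1)\<close> is \<open>1 - exp (- u)\<close>: a simple zero at 0 with
  slope \<open>\<beta> 0\<close>.\<close>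

lemma vp_flow_singularity:
  fixes x0 :: "real ^ 'm"
  assumes T: "0 < T" and B: "brownian_motion M B" and flow: "vp_flow M B T \<beta>min \<beta>max \<beta> X"
  defines "\<Gamma> \<equiv> malliavin_matrix (vp_diffusion \<beta>) X x0"
  obtains L where "0 < L"
    and "AE \<omega> in M. ((\<lambda>t. norm (matrix_inv (\<Gamma> t \<omega>)) * t) \<longlongrightarrow> L) (at_right 0)"
    and "AE \<omega> in M. (\<forall>t\<in>{0<..T}. invertible (\<Gamma> t \<omega>)) \<and>
      (\<lambda>t. norm (matrix_inv (\<Gamma> t \<omega>))) \<in> O[at_right 0](\<lambda>t. 1 / t) \<and>
      filterlim (\<lambda>t. norm (matrix_inv (\<Gamma> t \<omega>))) at_top (at_right 0)"
    and "AE \<omega> in M. matrix_inv (\<Gamma> T \<omega>) = (1 / (1 - exp (- int_schedule \<beta> T))) *\<^sub>R mat 1"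
proof -
  have \<beta>: "continuous_on {0..T} \<beta>" "0 < \<beta>min" "\<forall>t\<in>{0..T}. \<beta>min \<le> \<beta> t"
    and sde: "sde_flow M B T (vp_drift \<beta>) (vp_diffusion \<beta>) X"
    using flow by (auto simp: vp_flow_def)
  note d = int_schedule_has_derivative[OF \<beta>(1)]
  have \<beta>_pos: "0 < \<beta> t" if "t \<in> {0..T}" for t using \<beta>(2,3) that by (meson less_le_trans)
  have "AE \<omega> in M. \<forall>t\<in>{0..T}. malliavin_matrix (vp_diffusion \<beta>) X x0 t \<omega> =
      (exp (- int_schedule \<beta> t) * (exp (int_schedule \<beta> t) - exp (int_schedule \<beta> 0))) *\<^sub>R mat 1"
  proof (rule vp_drift_flow_malliavin_matrix[OF B sde \<beta>(1)])
    fix t assume t: "t \<in> {0..T}"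
    show "((\<lambda>t. exp (int_schedule \<beta> t)) has_real_derivative
        (sqrt (\<beta> t))\<^sup>2 * exp (int_schedule \<beta> t)) (at t within {0..T})"
      using d[OF t] \<beta>_pos[OF t] by (auto intro!: derivative_eq_intros)
  qed (rule vp_diffusion_def)
  moreover have "exp (- u) * (exp u - exp 0) = (1 - exp (- u)) ^ 1" for u :: real
    by (simp add: algebra_simps exp_add[symmetric])
  ultimately have "AE \<omega> in M. \<forall>t\<in>{0..T}. \<Gamma> t \<omega> = ((1 - exp (- int_schedule \<beta> t)) ^ 1) *\<^sub>R mat 1"
    by (simp only: \<Gamma>_def int_schedule_zero)
  moreover have "0 < 1 - exp (- int_schedule \<beta> t)" if "t \<in> {0<..T}" for t
    using int_schedule_ge[OF \<beta>(1,3), of t] mult_pos_pos[OF \<beta>(2), of t] that by simp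
  moreover have "((\<lambda>t. 1 - exp (- int_schedule \<beta> t)) has_real_derivative \<beta> 0) (at 0 within {0..T})"
    using d[of 0] T by (auto intro!: derivative_eq_intros)
  ultimately show ?thesis
    using AE_isotropic_singularity[OF T zero_less_one,
        where \<Gamma> = \<Gamma> and k = "\<lambda>t. 1 - exp (- int_schedule \<beta> t)" and M = M
          and c = "\<beta> 0" and thesis = thesis] that \<beta>_pos[of 0] T
    by simp
qed

text \<open>With u as the integrated schedule, the integrand is
  \<open>\<beta> t * (exp u - exp (- u))\<close>, with antiderivative
  \<open>exp u + exp (- u)\<close>. Subtracting its initial value 2 and multiplying by
  \<open>exp (- u)\<close> leaves the perfect square of the VP factor, so the zero at time 0 becomes
  double.\<close>

lemma subvp_flow_singularity:
  fixes x0 :: "real ^ 'm"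
  assumes T: "0 < T" and B: "brownian_motion M B" and flow: "subvp_flow M B T \<beta>min \<beta> X"
  defines "\<Gamma> \<equiv> malliavin_matrix (subvp_diffusion \<beta>) X x0"
  obtains L where "0 < L"
    and "AE \<omega> in M. ((\<lambda>t. norm (matrix_inv (\<Gamma> t \<omega>)) * t\<^sup>2) \<longlongrightarrow> L) (at_right 0)"
    and "AE \<omega> in M. (\<forall>t\<in>{0<..T}. invertible (\<Gamma> t \<omega>)) \<and>
      (\<lambda>t. norm (matrix_inv (\<Gamma> t \<omega>))) \<in> O[at_right 0](\<lambda>t. 1 / t\<^sup>2) \<and>
      filterlim (\<lambda>t. norm (matrix_inv (\<Gamma> t \<omega>))) at_top (at_right 0)"
    and "AE \<omega> in M. matrix_inv (\<Gamma> T \<omega>) = (1 / (1 - exp (- int_schedule \<beta> T))\<^sup>2) *\<^sub>R mat 1"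
proof -
  have \<beta>: "continuous_on {0..T} \<beta>" "0 < \<beta>min" "\<forall>t\<in>{0..T}. \<beta>min \<le> \<beta> t"
    and sde: "sde_flow M B T (vp_drift \<beta>) (subvp_diffusion \<beta>) X"
    using flow by (auto simp: subvp_flow_def)
  note d = int_schedule_has_derivative[OF \<beta>(1)]
  have \<beta>_pos: "0 < \<beta> t" if "t \<in> {0..T}" for t using \<beta>(2,3) that by (meson less_le_trans)
  have ge: "\<beta>min * t \<le> int_schedule \<beta> t" if "t \<in> {0..T}" for t
    using int_schedule_ge[OF \<beta>(1,3) that] .
  let ?G = "\<lambda>t. exp (int_schedule \<beta> t) + exp (- int_schedule \<beta> t)"
  have "AE \<omega> in M. \<forall>t\<in>{0..T}. malliavin_matrix (subvp_diffusion \<beta>) X x0 t \<omega> =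
      (exp (- int_schedule \<beta> t) * (?G t - ?G 0)) *\<^sub>R mat 1"
  proof (rule vp_drift_flow_malliavin_matrix[OF B sde \<beta>(1)])
    fix t assume t: "t \<in> {0..T}"
    \<comment> \<open>The sign of the integrated schedule is what makes the radicand nonnegative, so
      that squaring undoes the root.\<close>
    have "0 \<le> \<beta>min * t" using \<beta>(2) t by simp
    then have "0 \<le> int_schedule \<beta> t" using ge[OF t] by linarith
    then have "(sqrt (\<beta> t * (1 - exp (- 2 * int_schedule \<beta> t))))\<^sup>2 * exp (int_schedule \<beta> t) =
        \<beta> t * (1 - exp (- 2 * int_schedule \<beta> t)) * exp (int_schedule \<beta> t)"
      using \<beta>_pos[OF t] by simp
    also have "\<dots> = \<beta> t * (exp (int_schedule \<beta> t) - exp (- int_schedule \<beta> t))"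
      by (simp add: algebra_simps exp_add[symmetric])
    finally have *: "(sqrt (\<beta> t * (1 - exp (- 2 * int_schedule \<beta> t))))\<^sup>2 * exp (int_schedule \<beta> t) =
        \<beta> t * (exp (int_schedule \<beta> t) - exp (- int_schedule \<beta> t))" .
    show "(?G has_real_derivative
        (sqrt (\<beta> t * (1 - exp (- 2 * int_schedule \<beta> t))))\<^sup>2 * exp (int_schedule \<beta> t))
        (at t within {0..T})"
      unfolding * using d[OF t] by (auto intro!: derivative_eq_intros simp: algebra_simps)
  qed (rule subvp_diffusion_def)
  moreover have "exp (- u) * (exp u + exp (- u) - (exp 0 + exp (- 0))) = (1 - exp (- u))\<^sup>2"
    for u :: real
    by (simp add: algebra_simps power2_eq_square exp_add[symmetric])
  ultimately have "AE \<omega> in M. \<forall>t\<in>{0..T}. \<Gamma> t \<omega> = ((1 - exp (- int_schedule \<beta> t))\<^sup>2) *\<^sub>R mat 1"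
    by (simp only: \<Gamma>_def int_schedule_zero)
  moreover have "0 < 1 - exp (- int_schedule \<beta> t)" if "t \<in> {0<..T}" for t
    using ge[of t] mult_pos_pos[OF \<beta>(2), of t] that by simp
  moreover have "((\<lambda>t. 1 - exp (- int_schedule \<beta> t)) has_real_derivative \<beta> 0) (at 0 within {0..T})"
    using d[of 0] T by (auto intro!: derivative_eq_intros)
  ultimately show ?thesis
    using AE_isotropic_singularity[OF T pos2,
        where \<Gamma> = \<Gamma> and k = "\<lambda>t. 1 - exp (- int_schedule \<beta> t)" and M = M
          and c = "\<beta> 0" and thesis = thesis] that \<beta>_pos[of 0] T
    by simp
qed


section \<open>Collecting the rates and comparing them\<close>

text \<open>Invertibility on the half-open interval accompanies the rates because
  \<open>matrix_inv\<close> of a singular matrix is an arbitrary value. Singularity at 0 is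
  divergence of the norm, and the stronger rate of sub-VP is a little-o relation against each of the
  other models. The VP and sub-VP schedules may differ.\<close>

theorem theorem12:
  fixes M :: "'w measure"
    and B :: "real \<Rightarrow> 'w \<Rightarrow> real ^ 'm"
    and X_ve X_vp X_sub :: "real ^ 'm \<Rightarrow> real \<Rightarrow> 'w \<Rightarrow> real ^ 'm"
    and x0 :: "real ^ 'm"
    and T \<sigma>min \<sigma>max \<beta>min \<beta>max \<beta>min' :: real
    and \<beta> \<beta>' :: "real \<Rightarrow> real"
    and \<gamma>_ve \<gamma>_vp \<gamma>_sub :: "real \<Rightarrow> 'w \<Rightarrow> real ^ 'm ^ 'm"
  assumes "0 < T"
    and "brownian_motion M B"
    and "\<gamma>_ve = malliavin_matrix (ve_diffusion T \<sigma>min \<sigma>max) X_ve x0"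
    and "\<gamma>_vp = malliavin_matrix (vp_diffusion \<beta>) X_vp x0"
    and "\<gamma>_sub = malliavin_matrix (subvp_diffusion \<beta>') X_sub x0"
  shows
    "(ve_flow M B T \<sigma>min \<sigma>max X_ve \<longrightarrow>
        (AE \<omega> in M.
           (\<forall>t\<in>{0<..T}. invertible (\<gamma>_ve t \<omega>)) \<and>
           (\<lambda>t. norm (matrix_inv (\<gamma>_ve t \<omega>))) \<in> O[at_right 0](\<lambda>t. 1 / t) \<and>
           filterlim (\<lambda>t. norm (matrix_inv (\<gamma>_ve t \<omega>))) at_top (at_right 0)) \<and>
        (AE \<omega> in M. matrix_inv (\<gamma>_ve T \<omega>) = (1 / (\<sigma>max\<^sup>2 - \<sigma>min\<^sup>2)) *\<^sub>R mat 1)) \<and>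
     (vp_flow M B T \<beta>min \<beta>max \<beta> X_vp \<longrightarrow>
        (AE \<omega> in M.
           (\<forall>t\<in>{0<..T}. invertible (\<gamma>_vp t \<omega>)) \<and>
           (\<lambda>t. norm (matrix_inv (\<gamma>_vp t \<omega>))) \<in> O[at_right 0](\<lambda>t. 1 / t) \<and>
           filterlim (\<lambda>t. norm (matrix_inv (\<gamma>_vp t \<omega>))) at_top (at_right 0)) \<and>
        (AE \<omega> in M. matrix_inv (\<gamma>_vp T \<omega>) = (1 / (1 - exp (- int_schedule \<beta> T))) *\<^sub>R mat 1)) \<and>
     (subvp_flow M B T \<beta>min' \<beta>' X_sub \<longrightarrow>
        (AE \<omega> in M.
           (\<forall>t\<in>{0<..T}. invertible (\<gamma>_sub t \<omega>)) \<and>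
           (\<lambda>t. norm (matrix_inv (\<gamma>_sub t \<omega>))) \<in> O[at_right 0](\<lambda>t. 1 / t\<^sup>2) \<and>
           filterlim (\<lambda>t. norm (matrix_inv (\<gamma>_sub t \<omega>))) at_top (at_right 0)) \<and>
        (AE \<omega> in M. matrix_inv (\<gamma>_sub T \<omega>) =
           (1 / (1 - exp (- int_schedule \<beta>' T))\<^sup>2) *\<^sub>R mat 1)) \<and>
     (ve_flow M B T \<sigma>min \<sigma>max X_ve \<and> subvp_flow M B T \<beta>min' \<beta>' X_sub \<longrightarrow>
        (AE \<omega> in M. (\<lambda>t. norm (matrix_inv (\<gamma>_ve t \<omega>))) \<in>
           o[at_right 0](\<lambda>t. norm (matrix_inv (\<gamma>_sub t \<omega>))))) \<and>
     (vp_flow M B T \<beta>min \<beta>max \<beta> X_vp \<and> subvp_flow M B T \<beta>min' \<beta>' X_sub \<longrightarrow>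
        (AE \<omega> in M. (\<lambda>t. norm (matrix_inv (\<gamma>_vp t \<omega>))) \<in>
           o[at_right 0](\<lambda>t. norm (matrix_inv (\<gamma>_sub t \<omega>)))))"
\<comment> \<open>The instance of \<open>conjI\<close> splits only conjunctions whose left side is
  an implication, so the pair of almost sure claims inside each conclusion stays together.\<close>
proof (intro conjI[of "_ \<longrightarrow> _"] impI; (elim conjE)?)
  note ve = ve_flow_singularity[where X = X_ve and ?x0.0 = x0 and \<sigma>min = \<sigma>min and \<sigma>max = \<sigma>max,
      OF assms(1,2), folded assms(3)]
  note vp = vp_flow_singularity[where X = X_vp and ?x0.0 = x0 and \<beta> = \<beta>,
      OF assms(1,2), folded assms(4)]
  note sub = subvp_flow_singularity[where X = X_sub and ?x0.0 = x0 and \<beta> = \<beta>',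
      OF assms(1,2), folded assms(5)]
  {
    assume "ve_flow M B T \<sigma>min \<sigma>max X_ve"
    then show "(AE \<omega> in M.
           (\<forall>t\<in>{0<..T}. invertible (\<gamma>_ve t \<omega>)) \<and>
           (\<lambda>t. norm (matrix_inv (\<gamma>_ve t \<omega>))) \<in> O[at_right 0](\<lambda>t. 1 / t) \<and>
           filterlim (\<lambda>t. norm (matrix_inv (\<gamma>_ve t \<omega>))) at_top (at_right 0)) \<and>
        (AE \<omega> in M. matrix_inv (\<gamma>_ve T \<omega>) = (1 / (\<sigma>max\<^sup>2 - \<sigma>min\<^sup>2)) *\<^sub>R mat 1)"
      by (rule ve) (rule conjI)
  next
    assume "vp_flow M B T \<beta>min \<beta>max \<beta> X_vp"
    then show "(AE \<omega> in M.
           (\<forall>t\<in>{0<..T}. invertible (\<gamma>_vp t \<omega>)) \<and>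
           (\<lambda>t. norm (matrix_inv (\<gamma>_vp t \<omega>))) \<in> O[at_right 0](\<lambda>t. 1 / t) \<and>
           filterlim (\<lambda>t. norm (matrix_inv (\<gamma>_vp t \<omega>))) at_top (at_right 0)) \<and>
        (AE \<omega> in M. matrix_inv (\<gamma>_vp T \<omega>) = (1 / (1 - exp (- int_schedule \<beta> T))) *\<^sub>R mat 1)"
      by (rule vp) (rule conjI)
  next
    assume "subvp_flow M B T \<beta>min' \<beta>' X_sub"
    then show "(AE \<omega> in M.
           (\<forall>t\<in>{0<..T}. invertible (\<gamma>_sub t \<omega>)) \<and>
           (\<lambda>t. norm (matrix_inv (\<gamma>_sub t \<omega>))) \<in> O[at_right 0](\<lambda>t. 1 / t\<^sup>2) \<and>
           filterlim (\<lambda>t. norm (matrix_inv (\<gamma>_sub t \<omega>))) at_top (at_right 0)) \<and>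
        (AE \<omega> in M. matrix_inv (\<gamma>_sub T \<omega>) =
           (1 / (1 - exp (- int_schedule \<beta>' T))\<^sup>2) *\<^sub>R mat 1)"
      by (rule sub) (rule conjI)
  next
    assume flows: "ve_flow M B T \<sigma>min \<sigma>max X_ve" "subvp_flow M B T \<beta>min' \<beta>' X_sub"
    obtain L where L: "AE \<omega> in M. ((\<lambda>t. norm (matrix_inv (\<gamma>_ve t \<omega>)) * t) \<longlongrightarrow> L) (at_right 0)"
      by (rule ve[OF flows(1)])
    obtain K where K: "0 < K"
      "AE \<omega> in M. ((\<lambda>t. norm (matrix_inv (\<gamma>_sub t \<omega>)) * t\<^sup>2) \<longlongrightarrow> K) (at_right 0)"
      by (rule sub[OF flows(2)])
    \<comment> \<open>Both limits hold on a common event of full measure; the poles have orders 1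
      and 2, and \<open>K\<close> is positive, so the comparison of poles applies path by
      path.\<close>
    from L K(2) show "AE \<omega> in M. (\<lambda>t. norm (matrix_inv (\<gamma>_ve t \<omega>))) \<in>
        o[at_right 0](\<lambda>t. norm (matrix_inv (\<gamma>_sub t \<omega>)))"
    proof eventually_elim
      case (elim \<omega>)
      show ?case
        by (rule smallo_higher_pole[where p = 1 and q = 2]) (use elim K(1) in auto)
    qed
  next
    assume flows: "vp_flow M B T \<beta>min \<beta>max \<beta> X_vp" "subvp_flow M B T \<beta>min' \<beta>' X_sub"
    obtain L where L: "AE \<omega> in M. ((\<lambda>t. norm (matrix_inv (\<gamma>_vp t \<omega>)) * t) \<longlongrightarrow> L) (at_right 0)"
      by (rule vp[OF flows(1)])
    obtain K where K: "0 < K"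
      "AE \<omega> in M. ((\<lambda>t. norm (matrix_inv (\<gamma>_sub t \<omega>)) * t\<^sup>2) \<longlongrightarrow> K) (at_right 0)"
      by (rule sub[OF flows(2)])
    from L K(2) show "AE \<omega> in M. (\<lambda>t. norm (matrix_inv (\<gamma>_vp t \<omega>))) \<in>
        o[at_right 0](\<lambda>t. norm (matrix_inv (\<gamma>_sub t \<omega>)))"
    proof eventually_elim
      case (elim \<omega>)
      show ?case
        by (rule smallo_higher_pole[where p = 1 and q = 2]) (use elim K(1) in auto)
    qed
  }
qed

end
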